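(* Let $\Gamma=(V,T,\mathbf{s},\mathbf{r})$ be a network such that there exists $t\in T$ with $|\mathbf{s}(t)|>1$. Then $Q_\Gamma$ and $S_\Gamma$ are not congruence-free as semigroups.
   Context: A network $\Gamma=(V,T,\mathbf{s},\mathbf{r})$ consists of a set $V$ of vertices, a set $T$ of relations, and maps $\mathbf{s},\mathbf{r}:T\to\mathcal{P}(V)$ such that for every $t\in T$ the sets $\mathbf{s}(t)$ and $\mathbf{r}(t)$ are disjoint non-empty subsets of $V$; $V$ and $T$ are finite or countably infinite. A vertex $v$ is identified with the singleton $\{v\}$. Put $T^0=\{A\subseteq V: A=\mathbf{s}(t)\text{ or }A=\mathbf{r}(t)\text{ for some }t\in T\}\cup V$, and set $\mathbf{s}(A)=A=\mathbf{r}(A)$ for $A\in T^0$. For each $t\in T$ let $t^{-1}$ be a formal symbol with $\mathbf{s}(t^{-1})=\mathbf{r}(t)$, $\mathbf{r}(t^{-1})=\mathbf{s}(t)$; put $A^{-1}=A$ for $A\in T^0$ and $T^{-1}=\{t^{-1}:t\in T\}$. The symbol sets $T$, $T^0$, $T^{-1}$, $\{0\}$ are pairwise disjoint. $Q_\Gamma$ is the semigroup generated by $X=T\cup T^0\cup T^{-1}\cup\{0\}$ subject to the relations: (NR1) $\mathbf{s}(t)t=t=t\mathbf{r}(t)$ for $t\in T\cup T^0\cup T^{-1}$; (NR2) $t_1t_2=0$ if $\mathbf{r}(t_1)\cap\mathbf{s}(t_2)=\emptyset$, for $t_1,t_2\in T\cup T^0\cup T^{-1}$; (NR3) $t_1^{-1}t_2=0$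 if $t_1\neq t_2$, for $t_1,t_2\in T$; (NR4) $t^{-1}t=\mathbf{r}(t)$ for $t\in T$; (NR5) $t^{-1}A=0$ if $\mathbf{s}(t)\neq A$, for $t\in T$, $A\in T^0$; (NR6) $0x=0=x0$ for all $x\in X$. $[w]$ denotes the class in $Q_\Gamma$ of a word $w$. A non-zero path is a finite non-empty sequence $\alpha=t_1\cdots t_n$ with $t_i\in T\cup T^0$ and $\mathbf{r}(t_i)\cap\mathbf{s}(t_{i+1})\neq\emptyset$ for $1\le i<n$; $\mathbf{s}(\alpha)=\mathbf{s}(t_1)$, $\mathbf{r}(\alpha)=\mathbf{r}(t_n)$, $\alpha^{-1}=t_n^{-1}\cdots t_1^{-1}$. It is linear if $\mathbf{r}(t_i)=\mathbf{s}(t_{i+1})$ for $1\le i<n$, and reduced if $t_i\neq\mathbf{s}(t_{i+1})$ and $t_{i+1}\neq\mathbf{r}(t_i)$ for $1\le i<n$. $RP(\Gamma)$ is the set of reduced paths (together with $0$) and $RLP(\Gamma)$ the set of non-zero reduced linear paths. $S_\Gamma=\{[\alpha\beta^{-1}]\in Q_\Gamma:\alpha\in RP(\Gamma)\setminus\{0\},\ \beta\in RLP(\Gamma)\setminus T^0,\ \mathbf{r}(\alpha)=\mathbf{r}(\beta)\}\cup\{[0]\}$, a subsemigroup of $Q_\Gamma$. A semigroup is congruence-free if its only congruences are the identity congruence and the universal congruence. *)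

theory Defs
  imports Main "HOL-Library.Countable_Set"
begin

section \<open>Congruences on semigroups and presentations\<close>

text \<open>A semigroup is given by a carrier set and a multiplication.\<close>

definition sg_congruence :: "'a set \<Rightarrow> ('a \<Rightarrow> 'a \<Rightarrow> 'a) \<Rightarrow> ('a \<times> 'a) set \<Rightarrow> bool" where
  "sg_congruence S m R \<longleftrightarrow>
     equiv S R \<and> (\<forall>a b c d. (a, b) \<in> R \<longrightarrow> (c, d) \<in> R \<longrightarrow> (m a c, m b d) \<in> R)"

definition congruence_free :: "'a set \<Rightarrow> ('a \<Rightarrow> 'a \<Rightarrow> 'a) \<Rightarrow> bool" where
  "congruence_free S m \<longleftrightarrow> (\<forall>R. sg_congruence S m R \<longrightarrow> R = Id_on S \<or> R = S \<times> S)"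

text \<open>The smallest congruence on \<open>S\<close> containing the set of pairs \<open>E\<close>; for
  \<open>E \<subseteq> S \<times> S\<close> the intersection is not over the empty family, since
  \<open>S \<times> S\<close> is a congruence.\<close>

definition generated_congruence ::
    "'a set \<Rightarrow> ('a \<Rightarrow> 'a \<Rightarrow> 'a) \<Rightarrow> ('a \<times> 'a) set \<Rightarrow> ('a \<times> 'a) set" where
  "generated_congruence S m E = \<Inter>{R. sg_congruence S m R \<and> E \<subseteq> R}"

definition free_semigroup :: "'a set \<Rightarrow> 'a list set" where
  "free_semigroup X = lists X - {[]}"

definition presented_congruence :: "'a set \<Rightarrow> ('a list \<times> 'a list) set \<Rightarrow> ('a list \<times> 'a list) set"
  where "presented_congruence X E = generated_congruence (free_semigroup X) (@) E"

definition presented_carrier :: "'a set \<Rightarrow> ('a list \<times> 'a list) set \<Rightarrow> 'a list set set" where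
  "presented_carrier X E = free_semigroup X // presented_congruence X E"

definition presented_mult ::
    "'a set \<Rightarrow> ('a list \<times> 'a list) set \<Rightarrow> 'a list set \<Rightarrow> 'a list set \<Rightarrow> 'a list set" where
  "presented_mult X E A B = (\<Union>u\<in>A. \<Union>w\<in>B. presented_congruence X E `` {u @ w})"

lemma sg_congruence_generated:
  assumes closed: "\<And>a b. a \<in> S \<Longrightarrow> b \<in> S \<Longrightarrow> m a b \<in> S" and E: "E \<subseteq> S \<times> S"
  shows "sg_congruence S m (generated_congruence S m E)"
proof -
  have "sg_congruence S m (S \<times> S)"
    unfolding sg_congruence_def
    by (auto intro!: equivI refl_onI symI transI closed)
  hence sub: "generated_congruence S m E \<subseteq> S \<times> S"
    unfolding generated_congruence_def using E by blast
  show ?thesis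
    unfolding sg_congruence_def
  proof (intro conjI allI impI equivI)
    show "generated_congruence S m E \<subseteq> S \<times> S" by (rule sub)
    show "refl_on S (generated_congruence S m E)"
      by (auto simp: generated_congruence_def sg_congruence_def equiv_def refl_on_def)
    show "sym (generated_congruence S m E)"
      by (auto simp: generated_congruence_def sg_congruence_def equiv_def intro!: symI dest: symD)
    show "trans (generated_congruence S m E)"
      by (rule transI) (auto simp: generated_congruence_def sg_congruence_def equiv_def dest: transD)
  next
    fix a b c d
    assume "(a, b) \<in> generated_congruence S m E" "(c, d) \<in> generated_congruence S m E"
    thus "(m a c, m b d) \<in> generated_congruence S m E"
      by (auto simp: generated_congruence_def sg_congruence_def)
  qed
qed

lemma sg_congruence_presented:
  assumes "E \<subseteq> free_semigroup X \<times> free_semigroup X"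
  shows "sg_congruence (free_semigroup X) (@) (presented_congruence X E)"
  unfolding presented_congruence_def
  by (rule sg_congruence_generated[OF _ assms]) (auto simp: free_semigroup_def)

lemma presented_mult_classes:
  assumes E: "E \<subseteq> free_semigroup X \<times> free_semigroup X"
    and "u \<in> free_semigroup X" "w \<in> free_semigroup X"
  shows "presented_mult X E (presented_congruence X E `` {u}) (presented_congruence X E `` {w})
       = presented_congruence X E `` {u @ w}"
proof -
  let ?R = "presented_congruence X E"
  have eq: "equiv (free_semigroup X) ?R"
    and cong: "\<And>a b c d. (a, b) \<in> ?R \<Longrightarrow> (c, d) \<in> ?R \<Longrightarrow> (a @ c, b @ d) \<in> ?R"
    using sg_congruence_presented[OF E] by (auto simp: sg_congruence_def)
  have "congruent2 ?R ?R (\<lambda>u w. ?R `` {u @ w})"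
    using cong by (auto intro!: congruent2I' equiv_class_eq[OF eq])
  from UN_equiv_class2[OF eq eq this assms(2,3)] show ?thesis
    by (simp add: presented_mult_def)
qed


section \<open>Networks\<close>

record ('v, 't) network =
  verts :: "'v set"
  rels :: "'t set"
  src :: "'t \<Rightarrow> 'v set"
  rng :: "'t \<Rightarrow> 'v set"

definition is_network :: "('v, 't) network \<Rightarrow> bool" where
  "is_network \<Gamma> \<longleftrightarrow>
     countable (verts \<Gamma>) \<and> countable (rels \<Gamma>) \<and>
     (\<forall>t \<in> rels \<Gamma>.
        src \<Gamma> t \<subseteq> verts \<Gamma> \<and> rng \<Gamma> t \<subseteq> verts \<Gamma> \<and>
        src \<Gamma> t \<noteq> {} \<and> rng \<Gamma> t \<noteq> {} \<and> src \<Gamma> t \<inter> rng \<Gamma> t = {})"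

text \<open>A vertex \<open>v\<close> is identified with \<open>{v}\<close>.\<close>

definition T0 :: "('v, 't) network \<Rightarrow> 'v set set" where
  "T0 \<Gamma> = src \<Gamma> ` rels \<Gamma> \<union> rng \<Gamma> ` rels \<Gamma> \<union> (\<lambda>v. {v}) ` verts \<Gamma>"

text \<open>\<open>Inv t\<close> is the formal inverse of \<open>t \<in> T\<close>, and \<open>Obj A\<close> is the symbol for
  \<open>A \<in> T0 \<Gamma>\<close>.\<close>

datatype ('v, 't) symb = Rel 't | Obj "'v set" | Inv 't | Zero

text \<open>The values of the following three functions at \<open>Zero\<close>, and of \<open>inv_symb\<close> at
  \<open>Inv t\<close>, are not relevant to the definitions below.\<close>

fun src_symb :: "('v, 't) network \<Rightarrow> ('v, 't) symb \<Rightarrow> 'v set" where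
  "src_symb \<Gamma> (Rel t) = src \<Gamma> t"
| "src_symb \<Gamma> (Obj A) = A"
| "src_symb \<Gamma> (Inv t) = rng \<Gamma> t"
| "src_symb \<Gamma> Zero = {}"

fun rng_symb :: "('v, 't) network \<Rightarrow> ('v, 't) symb \<Rightarrow> 'v set" where
  "rng_symb \<Gamma> (Rel t) = rng \<Gamma> t"
| "rng_symb \<Gamma> (Obj A) = A"
| "rng_symb \<Gamma> (Inv t) = src \<Gamma> t"
| "rng_symb \<Gamma> Zero = {}"

fun inv_symb :: "('v, 't) symb \<Rightarrow> ('v, 't) symb" where
  "inv_symb (Rel t) = Inv t"
| "inv_symb (Obj A) = Obj A"
| "inv_symb (Inv t) = Rel t"
| "inv_symb Zero = Zero"

definition nonzero_symbs :: "('v, 't) network \<Rightarrow> ('v, 't) symb set" where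
  "nonzero_symbs \<Gamma> = Rel ` rels \<Gamma> \<union> Obj ` T0 \<Gamma> \<union> Inv ` rels \<Gamma>"

definition symbs :: "('v, 't) network \<Rightarrow> ('v, 't) symb set" where
  "symbs \<Gamma> = nonzero_symbs \<Gamma> \<union> {Zero}"


section \<open>The semigroup \<open>Q_\<Gamma>\<close>\<close>

inductive_set Q_rels :: "('v, 't) network \<Rightarrow> (('v, 't) symb list \<times> ('v, 't) symb list) set"
  for \<Gamma> :: "('v, 't) network" where
  NR1_left: "x \<in> nonzero_symbs \<Gamma> \<Longrightarrow> ([Obj (src_symb \<Gamma> x), x], [x]) \<in> Q_rels \<Gamma>"
| NR1_right: "x \<in> nonzero_symbs \<Gamma> \<Longrightarrow> ([x, Obj (rng_symb \<Gamma> x)], [x]) \<in> Q_rels \<Gamma>"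
| NR2: "x \<in> nonzero_symbs \<Gamma> \<Longrightarrow> y \<in> nonzero_symbs \<Gamma> \<Longrightarrow> rng_symb \<Gamma> x \<inter> src_symb \<Gamma> y = {}
     \<Longrightarrow> ([x, y], [Zero]) \<in> Q_rels \<Gamma>"
| NR3: "t\<^sub>1 \<in> rels \<Gamma> \<Longrightarrow> t\<^sub>2 \<in> rels \<Gamma> \<Longrightarrow> t\<^sub>1 \<noteq> t\<^sub>2 \<Longrightarrow> ([Inv t\<^sub>1, Rel t\<^sub>2], [Zero]) \<in> Q_rels \<Gamma>"
| NR4: "t \<in> rels \<Gamma> \<Longrightarrow> ([Inv t, Rel t], [Obj (rng \<Gamma> t)]) \<in> Q_rels \<Gamma>"
| NR5: "t \<in> rels \<Gamma> \<Longrightarrow> A \<in> T0 \<Gamma> \<Longrightarrow> src \<Gamma> t \<noteq> A \<Longrightarrow> ([Inv t, Obj A], [Zero]) \<in> Q_rels \<Gamma>"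
| NR6_left: "x \<in> symbs \<Gamma> \<Longrightarrow> ([Zero, x], [Zero]) \<in> Q_rels \<Gamma>"
| NR6_right: "x \<in> symbs \<Gamma> \<Longrightarrow> ([x, Zero], [Zero]) \<in> Q_rels \<Gamma>"

definition Q_carrier :: "('v, 't) network \<Rightarrow> ('v, 't) symb list set set" where
  "Q_carrier \<Gamma> = presented_carrier (symbs \<Gamma>) (Q_rels \<Gamma>)"

definition Q_mult ::
    "('v, 't) network \<Rightarrow> ('v, 't) symb list set \<Rightarrow> ('v, 't) symb list set \<Rightarrow> ('v, 't) symb list set"
  where "Q_mult \<Gamma> = presented_mult (symbs \<Gamma>) (Q_rels \<Gamma>)"

definition Q_class :: "('v, 't) network \<Rightarrow> ('v, 't) symb list \<Rightarrow> ('v, 't) symb list set" where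
  "Q_class \<Gamma> w = presented_congruence (symbs \<Gamma>) (Q_rels \<Gamma>) `` {w}"

lemma T0_src_rng_symb:
  assumes "x \<in> nonzero_symbs \<Gamma>"
  shows "src_symb \<Gamma> x \<in> T0 \<Gamma>" "rng_symb \<Gamma> x \<in> T0 \<Gamma>"
  using assms by (auto simp: nonzero_symbs_def T0_def)

lemma symbs_simps [simp]:
  "Rel t \<in> symbs \<Gamma> \<longleftrightarrow> t \<in> rels \<Gamma>"
  "Inv t \<in> symbs \<Gamma> \<longleftrightarrow> t \<in> rels \<Gamma>"
  "Obj A \<in> symbs \<Gamma> \<longleftrightarrow> A \<in> T0 \<Gamma>"
  "Zero \<in> symbs \<Gamma>"
  by (auto simp: symbs_def nonzero_symbs_def)

lemma Q_rels_subset: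
  "Q_rels \<Gamma> \<subseteq> free_semigroup (symbs \<Gamma>) \<times> free_semigroup (symbs \<Gamma>)"
proof (rule subrelI)
  have sub: "x \<in> symbs \<Gamma>" if "x \<in> nonzero_symbs \<Gamma>" for x
    using that by (simp add: symbs_def)
  have "rng \<Gamma> t \<in> T0 \<Gamma>" if "t \<in> rels \<Gamma>" for t
    using that by (simp add: T0_def)
  note rules = this sub T0_src_rng_symb
  fix u w assume "(u, w) \<in> Q_rels \<Gamma>"
  thus "(u, w) \<in> free_semigroup (symbs \<Gamma>) \<times> free_semigroup (symbs \<Gamma>)"
    by cases (simp_all add: free_semigroup_def rules)
qed

lemma Q_mult_class:
  "u \<in> free_semigroup (symbs \<Gamma>) \<Longrightarrow> w \<in> free_semigroup (symbs \<Gamma>)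
    \<Longrightarrow> Q_mult \<Gamma> (Q_class \<Gamma> u) (Q_class \<Gamma> w) = Q_class \<Gamma> (u @ w)"
  unfolding Q_mult_def Q_class_def by (rule presented_mult_classes[OF Q_rels_subset])


section \<open>Paths and the semigroup \<open>S_\<Gamma>\<close>\<close>

definition nonzero_paths :: "('v, 't) network \<Rightarrow> ('v, 't) symb list set" where
  "nonzero_paths \<Gamma> = {\<alpha>. \<alpha> \<noteq> [] \<and> set \<alpha> \<subseteq> Rel ` rels \<Gamma> \<union> Obj ` T0 \<Gamma> \<and>
     successively (\<lambda>x y. rng_symb \<Gamma> x \<inter> src_symb \<Gamma> y \<noteq> {}) \<alpha>}"

definition linear_path :: "('v, 't) network \<Rightarrow> ('v, 't) symb list \<Rightarrow> bool" where
  "linear_path \<Gamma> \<alpha> \<longleftrightarrow> successively (\<lambda>x y. rng_symb \<Gamma> x = src_symb \<Gamma> y) \<alpha>"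

definition reduced_path :: "('v, 't) network \<Rightarrow> ('v, 't) symb list \<Rightarrow> bool" where
  "reduced_path \<Gamma> \<alpha> \<longleftrightarrow>
     successively (\<lambda>x y. x \<noteq> Obj (src_symb \<Gamma> y) \<and> y \<noteq> Obj (rng_symb \<Gamma> x)) \<alpha>"

definition rng_path :: "('v, 't) network \<Rightarrow> ('v, 't) symb list \<Rightarrow> 'v set" where
  "rng_path \<Gamma> \<alpha> = rng_symb \<Gamma> (last \<alpha>)"

definition inv_path :: "('v, 't) symb list \<Rightarrow> ('v, 't) symb list" where
  "inv_path \<alpha> = rev (map inv_symb \<alpha>)"

definition RP :: "('v, 't) network \<Rightarrow> ('v, 't) symb list set" where
  "RP \<Gamma> = {\<alpha> \<in> nonzero_paths \<Gamma>. reduced_path \<Gamma> \<alpha>} \<union> {[Zero]}"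

definition RLP :: "('v, 't) network \<Rightarrow> ('v, 't) symb list set" where
  "RLP \<Gamma> = {\<alpha> \<in> nonzero_paths \<Gamma>. linear_path \<Gamma> \<alpha> \<and> reduced_path \<Gamma> \<alpha>}"

text \<open>The multiplication of \<open>S_\<Gamma>\<close> is \<open>Q_mult \<Gamma>\<close>.\<close>

definition S_carrier :: "('v, 't) network \<Rightarrow> ('v, 't) symb list set set" where
  "S_carrier \<Gamma> =
     {Q_class \<Gamma> (\<alpha> @ inv_path \<beta>) | \<alpha> \<beta>.
        \<alpha> \<in> RP \<Gamma> - {[Zero]} \<and> \<beta> \<in> RLP \<Gamma> - {[Obj A] | A. A \<in> T0 \<Gamma>} \<and>
        rng_path \<Gamma> \<alpha> = rng_path \<Gamma> \<beta>}
     \<union> {Q_class \<Gamma> [Zero]}"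

end

theory Submission
  imports Defs
begin

text \<open>
  The proof exhibits one congruence that is neither trivial nor universal, on \<open>Q_\<Gamma>\<close> and, by
  restriction, on \<open>S_\<Gamma>\<close>.

  In \<open>Q_\<Gamma>\<close> two symbols may be composed as soon as the range of the first meets the source of the
  second. Asking for equality instead, so that non-linear products become \<open>0\<close>, gives the inverse
  semigroup of the directed graph whose vertices are the sets in \<open>T\<^sup>0\<close> and whose edges are the
  relations \<open>t\<close> from \<open>s(t)\<close> to \<open>r(t)\<close>, and \<open>Q_\<Gamma>\<close> maps onto it. The congruence is the kernel of
  this map, realised by an action on paths (\<open>act_word_kernel\<close>). It is not universal, since
  \<open>t t\<inverse>\<close> survives. It is not trivial if \<open>s(t)\<close> has a further element besides some \<open>v\<close>, since then
  \<open>v t t\<inverse>\<close> is sent to \<open>0\<close> although it is not \<open>0\<close> in \<open>Q_\<Gamma>\<close>.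

  Both claims about elements need a representation in which they do not act as \<open>0\<close>. A single
  construction serves: it depends on a relation between vertex sets which says when a path with
  source \<open>A\<close> may be continued to the left by a symbol with range \<open>B \<noteq> A\<close>. If the relation is empty,
  the result is the action of the graph inverse semigroup; if it is ``\<open>B\<close> meets \<open>A\<close>'', the result is
  an action of \<open>Q_\<Gamma>\<close> on which \<open>v t t\<inverse>\<close> is not \<open>0\<close>.

  Both witnesses lie in \<open>S_\<Gamma>\<close>. For the restriction to be a congruence \<open>S_\<Gamma>\<close> must be closed under
  multiplication; it is even a left ideal of \<open>Q_\<Gamma>\<close> (\<open>S_carrier_left_ideal\<close>), because every word in
  \<open>T \<union> T\<^sup>0\<close> followed by a word in \<open>T\<inverse>\<close>, both non-empty, represents an element of \<open>S_\<Gamma>\<close>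
  (\<open>positive_negative_in_S_carrier\<close>).
\<close>

section \<open>Congruences on presented semigroups and their subsemigroups\<close>

lemma sg_congruence_restrict:
  assumes R: "sg_congruence S m R" and "M \<subseteq> S"
    and closed: "\<And>a b. a \<in> M \<Longrightarrow> b \<in> M \<Longrightarrow> m a b \<in> M"
  shows "sg_congruence M m (R \<inter> M \<times> M)"
  unfolding sg_congruence_def
proof (intro conjI allI impI equivI)
  show "refl_on M (R \<inter> M \<times> M)"
    using assms by (auto simp: sg_congruence_def equiv_def refl_on_def)
  show "sym (R \<inter> M \<times> M)" "trans (R \<inter> M \<times> M)"
    using R by (auto simp: sg_congruence_def equiv_def sym_def intro!: transI dest: transD)
next
  fix a b c d assume "(a, b) \<in> R \<inter> M \<times> M" "(c, d) \<in> R \<inter> M \<times> M"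
  thus "(m a c, m b d) \<in> R \<inter> M \<times> M"
    using R closed by (auto simp: sg_congruence_def)
qed simp

lemma presented_congruence_least:
  assumes "sg_congruence (free_semigroup X) (@) K" "E \<subseteq> K"
  shows "presented_congruence X E \<subseteq> K"
  using assms by (auto simp: presented_congruence_def generated_congruence_def)

text \<open>The correspondence theorem: a congruence on words that respects the defining relations
  descends to the presented semigroup.\<close>

lemma sg_congruence_presented_quotient:
  fixes X :: "'a set"
  assumes E: "E \<subseteq> free_semigroup X \<times> free_semigroup X"
    and K: "sg_congruence (free_semigroup X) (@) K" and EK: "E \<subseteq> K"
  defines "cl \<equiv> \<lambda>u. presented_congruence X E `` {u}"
  shows "sg_congruence (presented_carrier X E) (presented_mult X E) {(cl u, cl w) |u w. (u, w) \<in> K}"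
    and "\<And>u w. u \<in> free_semigroup X \<Longrightarrow> w \<in> free_semigroup X
      \<Longrightarrow> (cl u, cl w) \<in> {(cl u, cl w) |u w. (u, w) \<in> K} \<longleftrightarrow> (u, w) \<in> K"
proof -
  let ?F = "free_semigroup X" and ?P = "presented_congruence X E"
  have P: "equiv ?F ?P"
    using sg_congruence_presented[OF E] by (simp add: sg_congruence_def)
  have PK: "?P \<subseteq> K"
    by (rule presented_congruence_least[OF K EK])
  have K': "equiv ?F K" "\<And>a b c d. (a, b) \<in> K \<Longrightarrow> (c, d) \<in> K \<Longrightarrow> (a @ c, b @ d) \<in> K"
    using K by (auto simp: sg_congruence_def)
  have K_F: "u \<in> ?F" "w \<in> ?F" if "(u, w) \<in> K" for u w
    using K'(1) that by (auto simp: equiv_def)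
  have K_eq: "(u, u) \<in> K" if "u \<in> ?F" for u
    using K'(1) that by (auto simp: equiv_def refl_on_def)
  have symK: "sym K" and transK: "trans K"
    using K'(1) by (auto simp: equiv_def)
  have cl_eq: "(u, w) \<in> K" if "cl u = cl w" "u \<in> ?F" "w \<in> ?F" for u w
    using that PK eq_equiv_class_iff[OF P] by (auto simp: cl_def)
  let ?R = "{(cl u, cl w) |u w. (u, w) \<in> K}"
  show R_iff: "(cl u, cl w) \<in> ?R \<longleftrightarrow> (u, w) \<in> K" if "u \<in> ?F" "w \<in> ?F" for u w
  proof
    assume "(cl u, cl w) \<in> ?R"
    then obtain u' w' where *: "cl u = cl u'" "cl w = cl w'" "(u', w') \<in> K" by auto
    have "(u, u') \<in> K" "(w', w) \<in> K"
      using * that K_F cl_eq by metis+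
    with *(3) show "(u, w) \<in> K" using transK by (meson transD)
  qed auto
  have car: "presented_carrier X E = cl ` ?F"
    by (auto simp: presented_carrier_def cl_def quotient_def)
  have mult: "presented_mult X E (cl u) (cl w) = cl (u @ w)" if "u \<in> ?F" "w \<in> ?F" for u w
    unfolding cl_def using presented_mult_classes[OF E that] .
  show "sg_congruence (presented_carrier X E) (presented_mult X E) ?R"
    unfolding sg_congruence_def
  proof (intro conjI allI impI equivI)
    show "?R \<subseteq> presented_carrier X E \<times> presented_carrier X E"
      using K_F by (auto simp: car)
    show "refl_on (presented_carrier X E) ?R"
      using K_eq by (auto simp: car refl_on_def)
    show "sym ?R"
      using symK by (auto simp: sym_def)
    show "trans ?R"
    proof (rule transI)
      fix a b c assume "(a, b) \<in> ?R" "(b, c) \<in> ?R"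
      then obtain u w w' z where *: "a = cl u" "b = cl w" "b = cl w'" "c = cl z"
          "(u, w) \<in> K" "(w', z) \<in> K" by auto
      have "(w, w') \<in> K" using * K_F cl_eq by metis
      with * have "(u, z) \<in> K" using transK by (meson transD)
      with * show "(a, c) \<in> ?R" by auto
    qed
  next
    fix a b c d assume "(a, b) \<in> ?R" "(c, d) \<in> ?R"
    then obtain u w u' w' where *: "a = cl u" "b = cl w" "c = cl u'" "d = cl w'"
        "(u, w) \<in> K" "(u', w') \<in> K" by auto
    have "(u @ u', w @ w') \<in> K" using * K'(2) by blast
    with * show "(presented_mult X E a c, presented_mult X E b d) \<in> ?R"
      using K_F by (auto simp: mult)
  qed
qed


section \<open>Actions of \<open>Q_\<Gamma>\<close> on marked paths\<close>

text \<open>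
  A state \<open>(A, l)\<close> is a path with source \<open>A\<close>; its relations are listed in \<open>l\<close>, and an entry
  \<open>Obj A'\<close> of \<open>l\<close> marks a non-linear junction, remembering the source \<open>A'\<close> that the part to the
  right of it had. A path with source \<open>A\<close> can be given the source \<open>B \<noteq> A\<close> by such a junction if
  \<open>C B A\<close> allows it; \<open>None\<close> is the zero of the action. The junction has to be recorded, rather than
  only the new source: if \<open>v\<close> and then \<open>s(t)\<close> were applied to a path that begins with \<open>t\<close>, the
  original path would reappear and \<open>t\<inverse>\<close> would not kill it, contrary to \<open>t\<inverse> s(t) v = t\<inverse> v = 0\<close>
  for \<open>{v} \<noteq> s(t)\<close>.
\<close>

definition coerce :: "('v set \<Rightarrow> 'v set \<Rightarrow> bool) \<Rightarrow> 'v set \<Rightarrow> 'v set \<times> ('v, 't) symb list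
    \<Rightarrow> ('v set \<times> ('v, 't) symb list) option" where
  "coerce C B p = (if fst p = B then Some p
     else if C B (fst p) then Some (B, Obj (fst p) # snd p) else None)"

fun act :: "('v, 't) network \<Rightarrow> ('v set \<Rightarrow> 'v set \<Rightarrow> bool) \<Rightarrow> ('v, 't) symb
    \<Rightarrow> 'v set \<times> ('v, 't) symb list \<Rightarrow> ('v set \<times> ('v, 't) symb list) option" where
  "act \<Gamma> C (Rel t) p = map_option (\<lambda>q. (src \<Gamma> t, Rel t # snd q)) (coerce C (rng \<Gamma> t) p)"
| "act \<Gamma> C (Obj A) p = coerce C A p"
| "act \<Gamma> C (Inv t) p = (if fst p = src \<Gamma> t \<and> snd p \<noteq> [] \<and> hd (snd p) = Rel t
     then Some (rng \<Gamma> t, tl (snd p)) else None)"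
| "act \<Gamma> C Zero p = None"

fun act_word :: "('v, 't) network \<Rightarrow> ('v set \<Rightarrow> 'v set \<Rightarrow> bool) \<Rightarrow> ('v, 't) symb list
    \<Rightarrow> 'v set \<times> ('v, 't) symb list \<Rightarrow> ('v set \<times> ('v, 't) symb list) option" where
  "act_word \<Gamma> C [] p = Some p"
| "act_word \<Gamma> C (x # w) p = Option.bind (act_word \<Gamma> C w p) (act \<Gamma> C x)"

definition act_word_kernel :: "('v, 't) network \<Rightarrow> ('v set \<Rightarrow> 'v set \<Rightarrow> bool)
    \<Rightarrow> (('v, 't) symb list \<times> ('v, 't) symb list) set" where
  "act_word_kernel \<Gamma> C = {(u, w). u \<in> free_semigroup (symbs \<Gamma>) \<and> w \<in> free_semigroup (symbs \<Gamma>) \<and>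
     act_word \<Gamma> C u = act_word \<Gamma> C w}"

lemma act_word_append:
  "act_word \<Gamma> C (u @ w) p = Option.bind (act_word \<Gamma> C w p) (act_word \<Gamma> C u)"
  by (induction u) (auto simp: Option.bind_assoc)

lemma sg_congruence_act_word_kernel:
  "sg_congruence (free_semigroup (symbs \<Gamma>)) (@) (act_word_kernel \<Gamma> C)"
  unfolding sg_congruence_def
proof (intro conjI allI impI equivI)
  fix a b c d assume "(a, b) \<in> act_word_kernel \<Gamma> C" "(c, d) \<in> act_word_kernel \<Gamma> C"
  moreover from this have "act_word \<Gamma> C (a @ c) = act_word \<Gamma> C (b @ d)"
    by (intro ext) (simp add: act_word_kernel_def act_word_append)
  ultimately show "(a @ c, b @ d) \<in> act_word_kernel \<Gamma> C"
    by (simp add: act_word_kernel_def free_semigroup_def)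
qed (auto simp: act_word_kernel_def refl_on_def sym_def trans_def)

lemma T0_nonempty: "is_network \<Gamma> \<Longrightarrow> A \<in> T0 \<Gamma> \<Longrightarrow> A \<noteq> {}"
  by (auto simp: is_network_def T0_def)

text \<open>The defining relations hold in the action. A symbol \<open>y\<close> produces a path with source \<open>s(y)\<close>,
  and \<open>x\<close> accepts such a path only if \<open>r(x)\<close> is equal to \<open>s(y)\<close> or \<open>C\<close>-related to it; both are
  impossible for disjoint sets, as these are non-empty. Since \<open>t\<inverse>\<close> undoes only a last step that
  was \<open>t\<close>, an object that changes the source stops it, as (NR5) demands.\<close>

lemma Q_rels_subset_act_word_kernel:
  assumes net: "is_network \<Gamma>" and C: "\<And>A B. C B A \<Longrightarrow> A \<inter> B \<noteq> {}"
  shows "Q_rels \<Gamma> \<subseteq> act_word_kernel \<Gamma> C"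
proof (rule subrelI)
  fix u w assume uw: "(u, w) \<in> Q_rels \<Gamma>"
  hence "act_word \<Gamma> C u p = act_word \<Gamma> C w p" for p
  proof cases
    case (NR1_left x)
    thus ?thesis
      by (cases x) (auto simp: coerce_def nonzero_symbs_def split: Option.bind_splits)
  next
    case (NR1_right x)
    thus ?thesis
      by (cases x) (auto simp: coerce_def nonzero_symbs_def split: Option.bind_splits)
  next
    case (NR2 x y)
    have "src_symb \<Gamma> y \<noteq> {}"
      using T0_nonempty[OF net] T0_src_rng_symb NR2 by blast
    hence *: "src_symb \<Gamma> y \<noteq> rng_symb \<Gamma> x" "\<not> C (rng_symb \<Gamma> x) (src_symb \<Gamma> y)"
      using NR2 C by blast+
    have out: "fst q = src_symb \<Gamma> y" if "act \<Gamma> C y p = Some q" for q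
      using that by (cases y) (auto simp: coerce_def split: if_splits)
    have "act \<Gamma> C x q = None" if "fst q = src_symb \<Gamma> y" for q
      using that * by (cases x) (auto simp: coerce_def)
    thus ?thesis using NR2 out by (auto split: Option.bind_splits)
  next
    case (NR5 t A)
    thus ?thesis by (auto simp: coerce_def split: Option.bind_splits)
  qed (auto simp: coerce_def prod_eq_iff split: Option.bind_splits)
  thus "(u, w) \<in> act_word_kernel \<Gamma> C"
    using uw Q_rels_subset by (auto simp: act_word_kernel_def)
qed


section \<open>\<open>S_\<Gamma>\<close> as a left ideal\<close>

lemma Q_class_eqI:
  assumes "(u, w) \<in> presented_congruence (symbs \<Gamma>) (Q_rels \<Gamma>)"
  shows "Q_class \<Gamma> u = Q_class \<Gamma> w"
proof -
  have "equiv (free_semigroup (symbs \<Gamma>)) (presented_congruence (symbs \<Gamma>) (Q_rels \<Gamma>))"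
    using sg_congruence_presented[OF Q_rels_subset, of \<Gamma>] by (simp add: sg_congruence_def)
  thus ?thesis unfolding Q_class_def using assms by (rule equiv_class_eq)
qed

lemma Q_rels_Q_class: "(u, w) \<in> Q_rels \<Gamma> \<Longrightarrow> Q_class \<Gamma> u = Q_class \<Gamma> w"
  by (rule Q_class_eqI) (auto simp: presented_congruence_def generated_congruence_def)

lemma Q_class_append_cong:
  assumes "Q_class \<Gamma> u = Q_class \<Gamma> u'" "Q_class \<Gamma> w = Q_class \<Gamma> w'"
    and "u \<in> free_semigroup (symbs \<Gamma>)" "u' \<in> free_semigroup (symbs \<Gamma>)"
        "w \<in> free_semigroup (symbs \<Gamma>)" "w' \<in> free_semigroup (symbs \<Gamma>)"
  shows "Q_class \<Gamma> (u @ w) = Q_class \<Gamma> (u' @ w')"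
  using assms by (metis Q_mult_class)

lemma Q_class_context:
  assumes "Q_class \<Gamma> u = Q_class \<Gamma> u'" "u \<in> free_semigroup (symbs \<Gamma>)" "u' \<in> free_semigroup (symbs \<Gamma>)"
    and pq: "set p \<subseteq> symbs \<Gamma>" "set q \<subseteq> symbs \<Gamma>"
  shows "Q_class \<Gamma> (p @ u @ q) = Q_class \<Gamma> (p @ u' @ q)"
proof -
  have uq: "Q_class \<Gamma> (u @ q) = Q_class \<Gamma> (u' @ q)"
  proof (cases "q = []")
    case False
    show ?thesis
      by (rule Q_class_append_cong[OF assms(1) refl assms(2,3)])
         (use pq False in \<open>auto simp: free_semigroup_def\<close>)
  qed (simp add: assms)
  show ?thesis
  proof (cases "p = []")
    case False
    show ?thesis
      by (rule Q_class_append_cong[OF refl uq])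
         (use assms False in \<open>auto simp: free_semigroup_def\<close>)
  qed (simp add: uq)
qed

lemma Q_class_replace:
  assumes "(u, u') \<in> Q_rels \<Gamma>" "set p \<subseteq> symbs \<Gamma>" "set q \<subseteq> symbs \<Gamma>"
  shows "Q_class \<Gamma> (p @ u @ q) = Q_class \<Gamma> (p @ u' @ q)"
  using assms Q_rels_subset by (intro Q_class_context Q_rels_Q_class) blast+

lemma Q_class_Zero_right: "set p \<subseteq> symbs \<Gamma> \<Longrightarrow> Q_class \<Gamma> (p @ [Zero]) = Q_class \<Gamma> [Zero]"
proof (induction p rule: rev_induct)
  case (snoc x p)
  with Q_class_replace[OF NR6_right, of x \<Gamma> p "[]"] show ?case by simp
qed simp

lemma Q_class_Zero:
  "set p \<subseteq> symbs \<Gamma> \<Longrightarrow> set q \<subseteq> symbs \<Gamma> \<Longrightarrow> Q_class \<Gamma> (p @ Zero # q) = Q_class \<Gamma> [Zero]"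
proof (induction q)
  case (Cons x q)
  with Q_class_replace[OF NR6_left, of x \<Gamma> p q] show ?case by simp
qed (simp add: Q_class_Zero_right)

lemma Q_class_zeroI:
  assumes "(u, [Zero]) \<in> Q_rels \<Gamma>" "set p \<subseteq> symbs \<Gamma>" "set q \<subseteq> symbs \<Gamma>"
  shows "Q_class \<Gamma> (p @ u @ q) = Q_class \<Gamma> [Zero]"
  using Q_class_replace[OF assms] Q_class_Zero[OF assms(2,3)] by simp

lemma not_successivelyE:
  assumes "\<not> successively P xs"
  obtains p x y q where "xs = p @ [x, y] @ q" "\<not> P x y"
  using assms
proof (induction xs arbitrary: thesis rule: induct_list012)
  case (3 x y zs)
  show ?case
  proof (cases "P x y")
    case True
    hence "\<not> successively P (y # zs)" using "3.prems"(2) by simp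
    then obtain p a b q where "y # zs = p @ [a, b] @ q" "\<not> P a b" by (rule "3.IH"(2)[rotated])
    thus ?thesis using "3.prems"(1)[of "x # p" a b q] by simp
  next
    case False
    thus ?thesis using "3.prems"(1)[of "[]"] by simp
  qed
qed simp_all

definition positive_symbs :: "('v, 't) network \<Rightarrow> ('v, 't) symb set" where
  "positive_symbs \<Gamma> = Rel ` rels \<Gamma> \<union> Obj ` T0 \<Gamma>"

lemma positive_symbsD:
  assumes "x \<in> positive_symbs \<Gamma>"
  shows "x \<in> nonzero_symbs \<Gamma>" "x \<in> symbs \<Gamma>"
  using assms by (auto simp: positive_symbs_def symbs_def nonzero_symbs_def)

lemma nonzero_paths_alt:
  "\<alpha> \<in> nonzero_paths \<Gamma> \<longleftrightarrow> \<alpha> \<noteq> [] \<and> set \<alpha> \<subseteq> positive_symbs \<Gamma> \<and>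
     successively (\<lambda>x y. rng_symb \<Gamma> x \<inter> src_symb \<Gamma> y \<noteq> {}) \<alpha>"
  by (simp add: nonzero_paths_def positive_symbs_def)

lemma positive_word_path_or_zero:
  assumes "\<alpha> \<noteq> []" "set \<alpha> \<subseteq> positive_symbs \<Gamma>" "\<alpha> \<notin> nonzero_paths \<Gamma>" "set w \<subseteq> symbs \<Gamma>"
  shows "Q_class \<Gamma> (\<alpha> @ w) = Q_class \<Gamma> [Zero]"
proof -
  obtain p x y q where *: "\<alpha> = p @ [x, y] @ q" "rng_symb \<Gamma> x \<inter> src_symb \<Gamma> y = {}"
    using assms not_successivelyE[of "\<lambda>x y. rng_symb \<Gamma> x \<inter> src_symb \<Gamma> y \<noteq> {}" \<alpha>]
    unfolding nonzero_paths_alt by metis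
  have "([x, y], [Zero]) \<in> Q_rels \<Gamma>"
    using * assms(2) by (intro NR2) (auto intro: positive_symbsD)
  moreover have "set p \<subseteq> symbs \<Gamma>" "set (q @ w) \<subseteq> symbs \<Gamma>"
    using * assms(2,4) by (auto dest: positive_symbsD)
  ultimately show ?thesis
    using Q_class_zeroI[of "[x, y]" \<Gamma> p "q @ w"] * by simp
qed

text \<open>An object that violates reducedness can be deleted by (NR1). The deletion changes neither the
  junctions with the neighbouring symbols nor the range, so the result is again a path.\<close>

lemma nonzero_path_reduce:
  assumes "\<alpha> \<in> nonzero_paths \<Gamma>"
  shows "\<exists>\<alpha>'. \<alpha>' \<in> nonzero_paths \<Gamma> \<and> reduced_path \<Gamma> \<alpha>' \<and> rng_path \<Gamma> \<alpha>' = rng_path \<Gamma> \<alpha> \<and>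
    (\<forall>w. set w \<subseteq> symbs \<Gamma> \<longrightarrow> Q_class \<Gamma> (\<alpha> @ w) = Q_class \<Gamma> (\<alpha>' @ w))"
  using assms
proof (induction \<alpha> rule: length_induct)
  case (1 \<alpha>)
  show ?case
  proof (cases "reduced_path \<Gamma> \<alpha>")
    case False
    then obtain p x y q where a: "\<alpha> = p @ [x, y] @ q"
      and xy: "x = Obj (src_symb \<Gamma> y) \<or> y = Obj (rng_symb \<Gamma> x)"
      using not_successivelyE unfolding reduced_path_def by (metis (lifting))
    have pos: "set p \<subseteq> symbs \<Gamma>" "set q \<subseteq> symbs \<Gamma>" "x \<in> nonzero_symbs \<Gamma>" "y \<in> nonzero_symbs \<Gamma>"
      using "1.prems" by (auto simp: a nonzero_paths_alt dest: positive_symbsD)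
    obtain z where z: "([x, y], [z]) \<in> Q_rels \<Gamma>" "p @ [z] @ q \<in> nonzero_paths \<Gamma>"
      "rng_path \<Gamma> (p @ [z] @ q) = rng_path \<Gamma> \<alpha>"
      using xy
    proof
      assume x: "x = Obj (src_symb \<Gamma> y)"
      show ?thesis
      proof
        show "([x, y], [y]) \<in> Q_rels \<Gamma>" using NR1_left[OF pos(4)] x by simp
        show "p @ [y] @ q \<in> nonzero_paths \<Gamma>"
          using "1.prems" x by (auto simp: a nonzero_paths_alt successively_append_iff)
        show "rng_path \<Gamma> (p @ [y] @ q) = rng_path \<Gamma> \<alpha>"
          by (simp add: a rng_path_def)
      qed
    next
      assume y: "y = Obj (rng_symb \<Gamma> x)"
      show ?thesis
      proof
        show "([x, y], [x]) \<in> Q_rels \<Gamma>" using NR1_right[OF pos(3)] y by simp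
        show "p @ [x] @ q \<in> nonzero_paths \<Gamma>"
          using "1.prems" y
          by (cases q) (auto simp: a nonzero_paths_alt successively_append_iff successively_Cons)
        show "rng_path \<Gamma> (p @ [x] @ q) = rng_path \<Gamma> \<alpha>"
          by (simp add: a y rng_path_def)
      qed
    qed
    obtain \<alpha>' where \<alpha>': "\<alpha>' \<in> nonzero_paths \<Gamma>" "reduced_path \<Gamma> \<alpha>'"
      "rng_path \<Gamma> \<alpha>' = rng_path \<Gamma> \<alpha>"
      "\<And>w. set w \<subseteq> symbs \<Gamma> \<Longrightarrow> Q_class \<Gamma> ((p @ [z] @ q) @ w) = Q_class \<Gamma> (\<alpha>' @ w)"
      using "1.IH"[rule_format, of "p @ [z] @ q"] z by (auto simp: a)
    have "Q_class \<Gamma> (\<alpha> @ w) = Q_class \<Gamma> (\<alpha>' @ w)" if "set w \<subseteq> symbs \<Gamma>" for w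
      using Q_class_replace[OF z(1), of p "q @ w"] pos that \<alpha>'(4)[OF that] by (simp add: a)
    with \<alpha>' show ?thesis by blast
  qed (use "1.prems" in blast)
qed

lemma S_carrierI:
  assumes "\<alpha> \<in> nonzero_paths \<Gamma>" "reduced_path \<Gamma> \<alpha>" "\<beta> \<in> RLP \<Gamma>" "\<And>A. \<beta> \<noteq> [Obj A]"
    "rng_path \<Gamma> \<alpha> = rng_path \<Gamma> \<beta>"
  shows "Q_class \<Gamma> (\<alpha> @ inv_path \<beta>) \<in> S_carrier \<Gamma>"
proof -
  have "\<alpha> \<noteq> [Zero]" using assms(1) by (auto simp: nonzero_paths_def)
  thus ?thesis using assms unfolding S_carrier_def RP_def by blast
qed

text \<open>The conditions in the definition of \<open>S_\<Gamma>\<close> on \<open>\<alpha>\<close>, on \<open>\<beta>\<close> and on their ranges only select a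
  normal form of the product. If \<open>\<beta>\<close> contains \<open>a b\<close> with \<open>r(a) \<noteq> s(b)\<close>, then
  \<open>b\<inverse> a\<inverse> = b\<inverse> r(a) a\<inverse> = 0\<close> by (NR1) and (NR5). The ranges are made equal by inserting \<open>r(\<beta>)\<close>
  in front of \<open>\<beta>\<inverse>\<close>, and then \<open>\<alpha>\<close> is either \<open>0\<close> by (NR2) or a path that can be reduced.\<close>

lemma positive_negative_in_S_carrier:
  fixes \<Gamma> :: "('v, 't) network"
  assumes net: "is_network \<Gamma>" and \<alpha>: "\<alpha> \<noteq> []" "set \<alpha> \<subseteq> positive_symbs \<Gamma>"
    and ts: "ts \<noteq> []" "set ts \<subseteq> rels \<Gamma>"
  shows "Q_class \<Gamma> (\<alpha> @ inv_path (map Rel ts)) \<in> S_carrier \<Gamma>"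
proof (cases "linear_path \<Gamma> (map Rel ts)")
  case False
  let ?w = "\<alpha> @ inv_path (map Rel ts)"
  obtain p a b q where split: "ts = p @ [a, b] @ q" and ab: "rng \<Gamma> a \<noteq> src \<Gamma> b"
    using False unfolding linear_path_def successively_map
    by (elim not_successivelyE) simp_all
  define u where "u = \<alpha> @ rev (map Inv q)"
  define w :: "('v, 't) symb list" where "w = rev (map Inv p)"
  have eq: "?w = u @ [Inv b, Inv a] @ w"
    by (simp add: split u_def w_def inv_path_def rev_map)
  have in_symbs: "set u \<subseteq> symbs \<Gamma>" "set w \<subseteq> symbs \<Gamma>" "a \<in> rels \<Gamma>" "b \<in> rels \<Gamma>"
    using \<alpha> ts by (auto simp: u_def w_def split dest: positive_symbsD)
  have a': "Inv a \<in> nonzero_symbs \<Gamma>" and r: "rng \<Gamma> a \<in> T0 \<Gamma>"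
    using in_symbs by (auto simp: nonzero_symbs_def T0_def)
  have "Q_class \<Gamma> ?w = Q_class \<Gamma> (u @ [Inv b] @ [Obj (rng \<Gamma> a), Inv a] @ w)"
    using Q_class_replace[OF NR1_left[OF a'], of "u @ [Inv b]" w] in_symbs
    by (simp add: eq)
  also have "\<dots> = Q_class \<Gamma> [Zero]"
    using Q_class_zeroI[OF NR5[OF in_symbs(4) r], of u "Inv a # w"] in_symbs ab by auto
  finally show ?thesis by (simp add: S_carrier_def)
next
  case True
  let ?\<beta> = "map Rel ts" and ?r = "rng \<Gamma> (last ts)"
  have last: "last ts \<in> rels \<Gamma>" using ts by auto
  hence r: "?r \<in> T0 \<Gamma>" and inv: "Inv (last ts) \<in> nonzero_symbs \<Gamma>"
    by (auto simp: T0_def nonzero_symbs_def)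
  have inv_symbs: "set (inv_path ?\<beta>) \<subseteq> symbs \<Gamma>"
    using ts by (auto simp: inv_path_def)
  have rl: "?\<beta> \<in> RLP \<Gamma>"
  proof -
    have "successively (\<lambda>a b. rng \<Gamma> a = src \<Gamma> b) ts"
      using True by (simp add: linear_path_def successively_map)
    hence "successively (\<lambda>a b. rng \<Gamma> a \<inter> src \<Gamma> b \<noteq> {}) ts"
      by (rule successively_mono) (use net ts in \<open>auto simp: is_network_def\<close>)
    moreover have "reduced_path \<Gamma> ?\<beta>"
      unfolding reduced_path_def successively_map by (simp add: successively_conv_nth)
    ultimately show ?thesis
      using ts True by (auto simp: RLP_def nonzero_paths_alt positive_symbs_def successively_map)
  qed
  have inv_path: "inv_path ?\<beta> = Inv (last ts) # inv_path (map Rel (butlast ts))"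
    using ts(1) by (cases ts rule: rev_cases) (simp_all add: inv_path_def)
  have eq: "Q_class \<Gamma> (\<alpha> @ inv_path ?\<beta>) = Q_class \<Gamma> ((\<alpha> @ [Obj ?r]) @ inv_path ?\<beta>)"
    using Q_class_replace[OF NR1_left[OF inv], of \<alpha> "inv_path (map Rel (butlast ts))"]
      inv_symbs \<alpha> by (auto simp: inv_path dest: positive_symbsD)
  show ?thesis
  proof (cases "\<alpha> @ [Obj ?r] \<in> nonzero_paths \<Gamma>")
    case True
    obtain \<alpha>' where \<alpha>': "\<alpha>' \<in> nonzero_paths \<Gamma>" "reduced_path \<Gamma> \<alpha>'"
      "rng_path \<Gamma> \<alpha>' = rng_path \<Gamma> (\<alpha> @ [Obj ?r])"
      "Q_class \<Gamma> ((\<alpha> @ [Obj ?r]) @ inv_path ?\<beta>) = Q_class \<Gamma> (\<alpha>' @ inv_path ?\<beta>)"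
      using nonzero_path_reduce[OF True] inv_symbs by blast
    have "rng_path \<Gamma> \<alpha>' = rng_path \<Gamma> ?\<beta>"
      using \<alpha>'(3) ts by (simp add: rng_path_def last_map)
    thus ?thesis
      using S_carrierI[OF \<alpha>'(1,2) rl] \<alpha>'(4) eq by auto
  next
    case False
    have "set (\<alpha> @ [Obj ?r]) \<subseteq> positive_symbs \<Gamma>"
      using \<alpha> r by (auto simp: positive_symbs_def)
    from positive_word_path_or_zero[OF _ this False inv_symbs] show ?thesis
      by (simp add: eq S_carrier_def)
  qed
qed

text \<open>By (NR1) and (NR3)--(NR5), \<open>t\<inverse>\<close> times the first symbol of \<open>\<alpha>\<close> is \<open>0\<close>, or an object, which
  can replace that symbol, or \<open>t\<inverse>\<close> again, which moves on to the next symbol. If \<open>\<alpha>\<close> is used up,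
  \<open>t\<inverse>\<close> joins the negative part and (NR1) supplies the object \<open>r(t)\<close> as the new positive part.\<close>

lemma inverse_positive_negative_in_S_carrier:
  assumes net: "is_network \<Gamma>" and t: "t \<in> rels \<Gamma>" and \<alpha>: "set \<alpha> \<subseteq> positive_symbs \<Gamma>"
    and ts: "ts \<noteq> []" "set ts \<subseteq> rels \<Gamma>"
  shows "Q_class \<Gamma> (Inv t # \<alpha> @ inv_path (map Rel ts)) \<in> S_carrier \<Gamma>"
  using \<alpha>
proof (induction \<alpha>)
  case Nil
  have in_symbs: "set (inv_path (map Rel ts)) \<subseteq> symbs \<Gamma>"
    using ts by (auto simp: inv_path_def)
  have "Inv t \<in> nonzero_symbs \<Gamma>" and r: "rng \<Gamma> t \<in> T0 \<Gamma>"
    using t by (auto simp: nonzero_symbs_def T0_def)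
  from Q_class_replace[OF NR1_left[OF this(1)], of "[]" "inv_path (map Rel ts)"]
  have "Q_class \<Gamma> (Inv t # inv_path (map Rel ts))
      = Q_class \<Gamma> ([Obj (rng \<Gamma> t)] @ inv_path (map Rel (ts @ [t])))"
    using in_symbs by (simp add: inv_path_def)
  also have "\<dots> \<in> S_carrier \<Gamma>"
    by (rule positive_negative_in_S_carrier[OF net])
       (use ts t r in \<open>auto simp: positive_symbs_def\<close>)
  finally show ?case by simp
next
  case (Cons x \<alpha>)
  let ?w = "\<alpha> @ inv_path (map Rel ts)"
  have w: "set ?w \<subseteq> symbs \<Gamma>"
    using Cons.prems ts by (auto simp: inv_path_def dest: positive_symbsD)
  have zero: ?case if "([Inv t, x], [Zero]) \<in> Q_rels \<Gamma>"
    using Q_class_zeroI[OF that, of "[]" ?w] w by (simp add: S_carrier_def)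
  consider s where "x = Rel s" "s \<in> rels \<Gamma>" "s \<noteq> t" | "x = Rel t"
    | A where "x = Obj A" "A \<in> T0 \<Gamma>" "A \<noteq> src \<Gamma> t" | "x = Obj (src \<Gamma> t)"
    using Cons.prems by (auto simp: positive_symbs_def)
  thus ?case
  proof cases
    case 1
    thus ?thesis using zero NR3 t by metis
  next
    case 2
    have "Q_class \<Gamma> (Inv t # (x # \<alpha>) @ inv_path (map Rel ts)) =
        Q_class \<Gamma> ((Obj (rng \<Gamma> t) # \<alpha>) @ inv_path (map Rel ts))"
      using Q_class_replace[OF NR4[OF t], of "[]" ?w] w 2 by simp
    also have "\<dots> \<in> S_carrier \<Gamma>"
      by (rule positive_negative_in_S_carrier[OF net])
         (use ts t Cons.prems in \<open>auto simp: positive_symbs_def T0_def\<close>)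
    finally show ?thesis .
  next
    case 3
    thus ?thesis using zero NR5 t by metis
  next
    case 4
    have "Inv t \<in> nonzero_symbs \<Gamma>" using t by (simp add: nonzero_symbs_def)
    from Q_class_replace[OF NR1_right[OF this], of "[]" ?w] show ?thesis
      using w 4 Cons by simp
  qed
qed

text \<open>A path in \<open>RLP(\<Gamma>) \<setminus> T\<^sup>0\<close> contains no objects: linearity would make an object equal to the
  adjacent range or source, which reducedness forbids.\<close>

lemma RLP_relations:
  assumes "\<beta> \<in> RLP \<Gamma> - {[Obj A] |A. A \<in> T0 \<Gamma>}"
  obtains ts where "\<beta> = map Rel ts" "ts \<noteq> []" "set ts \<subseteq> rels \<Gamma>"
proof -
  have \<beta>: "\<beta> \<noteq> []" "set \<beta> \<subseteq> Rel ` rels \<Gamma> \<union> Obj ` T0 \<Gamma>" "linear_path \<Gamma> \<beta>" "reduced_path \<Gamma> \<beta>"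
    using assms by (auto simp: RLP_def nonzero_paths_def)
  have "set \<beta> \<subseteq> Rel ` rels \<Gamma>"
  proof (rule ccontr)
    assume "\<not> set \<beta> \<subseteq> Rel ` rels \<Gamma>"
    then obtain A where A: "Obj A \<in> set \<beta>" "A \<in> T0 \<Gamma>" using \<beta>(2) by blast
    then obtain p q where pq: "\<beta> = p @ Obj A # q" by (meson split_list)
    show False
    proof (cases q)
      case (Cons y q')
      with \<beta>(3,4) pq show False
        by (auto simp: linear_path_def reduced_path_def successively_append_iff)
    next
      case Nil
      hence "p \<noteq> []" using pq A assms by auto
      with \<beta>(3,4) pq show False
        by (auto simp: linear_path_def reduced_path_def successively_append_iff)
    qed
  qed
  hence "\<beta> \<in> map Rel ` lists (rels \<Gamma>)" by (simp add: lists_image[symmetric] in_lists_conv_set subset_iff)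
  with \<beta>(1) that show ?thesis by (auto simp: in_lists_conv_set)
qed

lemma S_carrierE:
  assumes "c \<in> S_carrier \<Gamma>"
  obtains "c = Q_class \<Gamma> [Zero]"
  | \<alpha> ts where "c = Q_class \<Gamma> (\<alpha> @ inv_path (map Rel ts))" "\<alpha> \<noteq> []"
      "set \<alpha> \<subseteq> positive_symbs \<Gamma>" "ts \<noteq> []" "set ts \<subseteq> rels \<Gamma>"
  using assms unfolding S_carrier_def
proof (elim UnE CollectE exE conjE)
  fix \<alpha> \<beta>
  assume c: "c = Q_class \<Gamma> (\<alpha> @ inv_path \<beta>)" and \<alpha>: "\<alpha> \<in> RP \<Gamma> - {[Zero]}"
    and \<beta>: "\<beta> \<in> RLP \<Gamma> - {[Obj A] |A. A \<in> T0 \<Gamma>}"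
  obtain ts where "\<beta> = map Rel ts" "ts \<noteq> []" "set ts \<subseteq> rels \<Gamma>"
    using RLP_relations[OF \<beta>] by blast
  moreover have "\<alpha> \<noteq> []" "set \<alpha> \<subseteq> positive_symbs \<Gamma>"
    using \<alpha> by (auto simp: RP_def nonzero_paths_alt)
  ultimately show thesis using that(2) c by blast
qed simp

lemma S_carrier_word:
  assumes "c \<in> S_carrier \<Gamma>"
  obtains w where "c = Q_class \<Gamma> w" "w \<in> free_semigroup (symbs \<Gamma>)"
  using assms
proof (cases rule: S_carrierE)
  case 1
  thus ?thesis using that[of "[Zero]"] by (simp add: free_semigroup_def)
next
  case (2 \<alpha> ts)
  have "set (\<alpha> @ inv_path (map Rel ts)) \<subseteq> symbs \<Gamma>"
    using 2(2-) by (auto simp: inv_path_def dest: positive_symbsD)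
  hence "\<alpha> @ inv_path (map Rel ts) \<in> free_semigroup (symbs \<Gamma>)"
    using 2(2) by (auto simp: free_semigroup_def)
  thus ?thesis using that 2(1) by blast
qed

lemma S_carrier_subset: "S_carrier \<Gamma> \<subseteq> Q_carrier \<Gamma>"
  by (auto simp: Q_carrier_def presented_carrier_def Q_class_def quotient_def elim!: S_carrier_word)

lemma symb_mult_in_S_carrier:
  assumes net: "is_network \<Gamma>" and x: "x \<in> symbs \<Gamma>" and c: "c \<in> S_carrier \<Gamma>"
  shows "Q_mult \<Gamma> (Q_class \<Gamma> [x]) c \<in> S_carrier \<Gamma>"
  using c
proof (cases rule: S_carrierE)
  case 1
  thus ?thesis
    using x Q_class_Zero_right[of "[x]"]
    by (simp add: Q_mult_class free_semigroup_def S_carrier_def)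
next
  case (2 \<alpha> ts)
  let ?w = "\<alpha> @ inv_path (map Rel ts)"
  have w: "set ?w \<subseteq> symbs \<Gamma>"
    using 2 by (auto simp: inv_path_def dest: positive_symbsD)
  have mult: "Q_mult \<Gamma> (Q_class \<Gamma> [x]) c = Q_class \<Gamma> (x # ?w)"
    using 2 w x by (subst 2(1), subst Q_mult_class) (auto simp: free_semigroup_def)
  consider "x = Zero" | "x \<in> positive_symbs \<Gamma>" | t where "x = Inv t" "t \<in> rels \<Gamma>"
    using x by (auto simp: symbs_def nonzero_symbs_def positive_symbs_def)
  thus ?thesis
  proof cases
    case 1
    thus ?thesis unfolding mult
      using Q_class_Zero[of "[]" \<Gamma> ?w] w by (simp add: S_carrier_def)
  next
    case pos: 2
    show ?thesis unfolding mult
      using positive_negative_in_S_carrier[OF net, of "x # \<alpha>" ts] 2(2-) pos by simp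
  next
    case 3
    thus ?thesis unfolding mult
      using inverse_positive_negative_in_S_carrier[OF net, of t \<alpha> ts] 2(2-) by simp
  qed
qed

lemma S_carrier_left_ideal:
  assumes net: "is_network \<Gamma>" and "u \<in> free_semigroup (symbs \<Gamma>)" and c: "c \<in> S_carrier \<Gamma>"
  shows "Q_mult \<Gamma> (Q_class \<Gamma> u) c \<in> S_carrier \<Gamma>"
  using assms(2)
proof (induction u)
  case (Cons x u)
  have x: "x \<in> symbs \<Gamma>" "[x] \<in> free_semigroup (symbs \<Gamma>)"
    using Cons.prems by (auto simp: free_semigroup_def)
  show ?case
  proof (cases "u = []")
    case True
    thus ?thesis using symb_mult_in_S_carrier[OF net x(1) c] by simp
  next
    case False
    hence u: "u \<in> free_semigroup (symbs \<Gamma>)"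
      using Cons.prems by (auto simp: free_semigroup_def)
    obtain w where w: "c = Q_class \<Gamma> w" "w \<in> free_semigroup (symbs \<Gamma>)"
      using S_carrier_word[OF c] .
    have "u @ w \<in> free_semigroup (symbs \<Gamma>)" using u w(2) by (auto simp: free_semigroup_def)
    hence "Q_mult \<Gamma> (Q_class \<Gamma> (x # u)) c = Q_mult \<Gamma> (Q_class \<Gamma> [x]) (Q_mult \<Gamma> (Q_class \<Gamma> u) c)"
      using Cons.prems x u w by (simp add: Q_mult_class)
    thus ?thesis using symb_mult_in_S_carrier[OF net x(1)] Cons.IH[OF u] by simp
  qed
qed (simp add: free_semigroup_def)


section \<open>The congruence\<close>

text \<open>A congruence on \<open>S\<close> refutes congruence-freeness of every subsemigroup that contains one pair
  witnessing that it is not trivial and one pair witnessing that it is not universal.\<close>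

lemma not_congruence_freeI:
  assumes "sg_congruence S m R" "M \<subseteq> S" "\<And>a b. a \<in> M \<Longrightarrow> b \<in> M \<Longrightarrow> m a b \<in> M"
    and "a \<in> M" "b \<in> M" "c \<in> M" "(a, c) \<in> R" "a \<noteq> c" "(b, c) \<notin> R"
  shows "\<not> congruence_free M m"
proof
  assume "congruence_free M m"
  moreover have "sg_congruence M m (R \<inter> M \<times> M)"
    by (rule sg_congruence_restrict[OF assms(1-3)])
  ultimately have "R \<inter> M \<times> M = Id_on M \<or> R \<inter> M \<times> M = M \<times> M"
    by (simp add: congruence_free_def)
  thus False
  proof
    assume "R \<inter> M \<times> M = Id_on M"
    hence "(a, c) \<in> Id_on M" using assms(4,6,7) by blast
    with \<open>a \<noteq> c\<close> show False by auto
  next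
    assume "R \<inter> M \<times> M = M \<times> M"
    hence "(b, c) \<in> R" using assms(5,6) by blast
    with \<open>(b, c) \<notin> R\<close> show False ..
  qed
qed

theorem theorem4p3:
  fixes \<Gamma> :: "('v, 't) network"
  assumes "is_network \<Gamma>"
    and "\<exists>t \<in> rels \<Gamma>. infinite (src \<Gamma> t) \<or> card (src \<Gamma> t) > 1"
  shows "\<not> congruence_free (Q_carrier \<Gamma>) (Q_mult \<Gamma>) \<and>
         \<not> congruence_free (S_carrier \<Gamma>) (Q_mult \<Gamma>)"
proof -
  note net = assms(1)
  let ?F = "free_semigroup (symbs \<Gamma>)"
  obtain t where t: "t \<in> rels \<Gamma>" and big: "infinite (src \<Gamma> t) \<or> card (src \<Gamma> t) > 1"
    using assms(2) by blast
  have "src \<Gamma> t \<noteq> {}" "src \<Gamma> t \<subseteq> verts \<Gamma>" using net t by (auto simp: is_network_def)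
  then obtain v where v: "v \<in> src \<Gamma> t" "v \<in> verts \<Gamma>" by blast
  have v_ne: "src \<Gamma> t \<noteq> {v}" using big by auto
  have T0: "{v} \<in> T0 \<Gamma>" using v by (auto simp: T0_def)

  \<comment> \<open>The state \<open>?p\<close> is the path \<open>t\<close>, which \<open>t t\<inverse>\<close> fixes under either action.\<close>
  let ?vtt = "[Obj {v}, Rel t, Inv t]" and ?tt = "[Rel t, Inv t]"
  let ?p = "(src \<Gamma> t, [Rel t])"
  have F: "?vtt \<in> ?F" "?tt \<in> ?F" "[Zero] \<in> ?F"
    using t T0 by (auto simp: free_semigroup_def)

  let ?lin = "\<lambda>B A :: 'v set. False" and ?meet = "\<lambda>B A :: 'v set. A \<inter> B \<noteq> {}"
  note K = sg_congruence_act_word_kernel[of \<Gamma> ?lin]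
  note K_rels = Q_rels_subset_act_word_kernel[OF net, of ?lin, simplified]
  define R where "R = {(Q_class \<Gamma> u, Q_class \<Gamma> w) |u w. (u, w) \<in> act_word_kernel \<Gamma> ?lin}"
  have R: "sg_congruence (Q_carrier \<Gamma>) (Q_mult \<Gamma>) R"
    using sg_congruence_presented_quotient(1)[OF Q_rels_subset K K_rels]
    by (simp add: R_def Q_carrier_def Q_mult_def Q_class_def)
  have R_iff: "(Q_class \<Gamma> u, Q_class \<Gamma> w) \<in> R \<longleftrightarrow> (u, w) \<in> act_word_kernel \<Gamma> ?lin"
    if "u \<in> ?F" "w \<in> ?F" for u w
    using sg_congruence_presented_quotient(2)[OF Q_rels_subset K K_rels that]
    by (simp add: R_def Q_class_def)

  \<comment> \<open>After \<open>t\<close> every path has source \<open>s(t) \<noteq> {v}\<close>, so \<open>v\<close> annihilates it.\<close>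
  have "act_word \<Gamma> ?lin ?vtt = act_word \<Gamma> ?lin [Zero]"
    using v_ne by (auto simp: fun_eq_iff coerce_def split: Option.bind_splits)
  hence vtt_R: "(Q_class \<Gamma> ?vtt, Q_class \<Gamma> [Zero]) \<in> R"
    using F by (simp add: R_iff act_word_kernel_def)

  have "act_word \<Gamma> ?lin ?tt ?p \<noteq> act_word \<Gamma> ?lin [Zero] ?p"
    by (simp add: coerce_def)
  hence "act_word \<Gamma> ?lin ?tt \<noteq> act_word \<Gamma> ?lin [Zero]"
    by (rule contrapos_nn) (erule fun_cong)
  hence tt_R: "(Q_class \<Gamma> ?tt, Q_class \<Gamma> [Zero]) \<notin> R"
    using F by (simp add: R_iff act_word_kernel_def del: act_word.simps)

  have vtt_nonzero: "Q_class \<Gamma> ?vtt \<noteq> Q_class \<Gamma> [Zero]"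
  proof
    assume "Q_class \<Gamma> ?vtt = Q_class \<Gamma> [Zero]"
    hence "(?vtt, [Zero]) \<in> presented_congruence (symbs \<Gamma>) (Q_rels \<Gamma>)"
      using F sg_congruence_presented[OF Q_rels_subset, of \<Gamma>]
      by (auto simp: Q_class_def sg_congruence_def eq_equiv_class_iff)
    also have "\<dots> \<subseteq> act_word_kernel \<Gamma> ?meet"
      by (intro presented_congruence_least sg_congruence_act_word_kernel
          Q_rels_subset_act_word_kernel net)
    finally have "act_word \<Gamma> ?meet ?vtt ?p = act_word \<Gamma> ?meet [Zero] ?p"
      by (simp add: act_word_kernel_def)
    thus False using v v_ne by (auto simp: coerce_def)
  qed

  have S: "Q_class \<Gamma> ?vtt \<in> S_carrier \<Gamma>" "Q_class \<Gamma> ?tt \<in> S_carrier \<Gamma>"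
      "Q_class \<Gamma> [Zero] \<in> S_carrier \<Gamma>"
    using positive_negative_in_S_carrier[OF net, of "[Obj {v}, Rel t]" "[t]"]
      positive_negative_in_S_carrier[OF net, of "[Rel t]" "[t]"] t T0
    by (auto simp: positive_symbs_def inv_path_def S_carrier_def)

  have Q_word: "\<exists>u \<in> ?F. a = Q_class \<Gamma> u" if "a \<in> Q_carrier \<Gamma>" for a
    using that by (auto simp: Q_carrier_def presented_carrier_def Q_class_def quotient_def)
  have Q_class_Q: "Q_class \<Gamma> u \<in> Q_carrier \<Gamma>" if "u \<in> ?F" for u
    using that by (auto simp: Q_carrier_def presented_carrier_def Q_class_def quotient_def)
  have Q_closed: "Q_mult \<Gamma> a b \<in> Q_carrier \<Gamma>" if ab: "a \<in> Q_carrier \<Gamma>" "b \<in> Q_carrier \<Gamma>" for a b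
  proof -
    obtain u w where uw: "u \<in> ?F" "a = Q_class \<Gamma> u" "w \<in> ?F" "b = Q_class \<Gamma> w"
      using ab Q_word by metis
    hence "u @ w \<in> ?F" by (auto simp: free_semigroup_def)
    thus ?thesis using uw by (simp add: Q_mult_class Q_class_Q)
  qed
  have S_closed: "Q_mult \<Gamma> a b \<in> S_carrier \<Gamma>" if "a \<in> S_carrier \<Gamma>" "b \<in> S_carrier \<Gamma>" for a b
    using that S_carrier_word[OF that(1)] S_carrier_left_ideal[OF net] by metis

  have "\<not> congruence_free (Q_carrier \<Gamma>) (Q_mult \<Gamma>)"
    by (rule not_congruence_freeI[OF R order_refl Q_closed Q_class_Q[OF F(1)] Q_class_Q[OF F(2)]
          Q_class_Q[OF F(3)] vtt_R vtt_nonzero tt_R])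
  moreover have "\<not> congruence_free (S_carrier \<Gamma>) (Q_mult \<Gamma>)"
    by (rule not_congruence_freeI[OF R S_carrier_subset S_closed S vtt_R vtt_nonzero tt_R])
  ultimately show ?thesis ..
qed

end
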